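(* Let $G=(V,E,O,Pr)$ be a parity game and $J=(V,D,H)$ a winning justification for $G$. Then $H$ is the winning function of the parametrized parity game $G_{P_J}$, and $\sigma_{J,0}$ and $\sigma_{J,1}$ are corresponding winning strategies: for each player $\alpha$ and each node $v$ with $H(v)=\alpha$, every play of $G_{P_J}$ starting in $v$ and consistent with $\sigma_{J,\alpha}$ is won by $\alpha$.
   Context: A parity game is a tuple $G=(V,E,O,Pr)$ with nodes $V$, moves $E\subseteq V\times V$ (every node has an outgoing edge), owner function $O:V\to\{0,1\}$ (player 0 = Even, 1 = Odd) and priority function $Pr:V\to\mathbb{N}$; $\bar\alpha=1-\alpha$, $O_\alpha=\{v\mid O(v)=\alpha\}$. A play of $G$ is an infinite sequence $v_1,v_2,\dots$ with $(v_i,v_{i+1})\in E$, won by player $(n\bmod 2)$ where $n$ is the highest priority occurring infinitely often. A parametrized parity game $G_P$ consists of $G$ and a partial function $P:V\rightharpoonup\{0,1\}$. A play of $G_P$ is a sequence $v_0,v_1,\dots$ such that if $v_i\in dom(P)$ the play halts and is won by $P(v_i)$, otherwise $v_{i+1}$ exists with $(v_i,v_{i+1})\in E$; infinite plays are won as in $G$. A strategy for $\alpha$ is a partial function $\sigma$ from a subset of $O_\alpha$ to $V$; a play is consistent with $\sigma$ if whenever a node $v_i$ of the play lies in $dom(\sigma)$ and is followed by $v_{i+1}$, then $v_{i+1}=\sigma(v_i)$. $G_P$ is determined, and its winning function $W:V\to\{0,1\}$ maps each node to the player who has a strategy such that all plays from that node consistent with it are won by that player. A direct justification for $\alpha$ to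 win $v$ is a set consisting of one outgoing edge of $v$ if $O(v)=\alpha$ and all outgoing edges of $v$ if $O(v)=\bar\alpha$; it wins $v$ for $\alpha$ under $H:V\to\{0,1\}$ if $H(w)=\alpha$ for all its edges $(v,w)$. A justification is $J=(V,D,H)$ with $D\subseteq E$, $H:V\to\{0,1\}$; a node is justified if it has outgoing edges in $D$, otherwise unjustified. $J$ is weakly winning if every justified node's set of outgoing $D$-edges is a direct justification winning it for $H(v)$ under $H$. $J$ is winning if it is weakly winning and every infinite path $v_1,v_2,\dots$ in $(V,D)$ is a play of $G$ won by $H(v_1)$. $G_{P_J}$ is the parametrized parity game with $P_J$ the restriction of $H$ to unjustified nodes. $\sigma_{J,\alpha}=\{(v,w)\in D\mid O(v)=H(v)=\alpha\}$. *)

theory Defs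
  imports Main
begin

datatype player = Even | Odd

fun opponent :: "player \<Rightarrow> player" where
  "opponent Even = Odd"
| "opponent Odd = Even"

definition player_of_priority :: "nat \<Rightarrow> player" where
  "player_of_priority n = (if n mod 2 = 0 then Even else Odd)"

record 'v parity_game =
  nodes :: "'v set"
  moves :: "('v \<times> 'v) set"
  owner :: "'v \<Rightarrow> player"
  priority :: "'v \<Rightarrow> nat"

text \<open>The values of \<open>owner\<close> and \<open>priority\<close> outside \<open>nodes\<close> are irrelevant.
  The set of nodes may be infinite.\<close>

definition is_parity_game :: "'v parity_game \<Rightarrow> bool" where
  "is_parity_game G \<longleftrightarrow>
     moves G \<subseteq> nodes G \<times> nodes G \<and> (\<forall>v\<in>nodes G. \<exists>w. (v, w) \<in> moves G)"

definition infinite_path :: "('v \<times> 'v) set \<Rightarrow> (nat \<Rightarrow> 'v) \<Rightarrow> bool" where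
  "infinite_path R s \<longleftrightarrow> (\<forall>i. (s i, s (Suc i)) \<in> R)"

definition game_play :: "'v parity_game \<Rightarrow> (nat \<Rightarrow> 'v) \<Rightarrow> bool" where
  "game_play G s \<longleftrightarrow> infinite_path (moves G) s"

definition highest_inf_priority :: "'v parity_game \<Rightarrow> (nat \<Rightarrow> 'v) \<Rightarrow> nat \<Rightarrow> bool" where
  "highest_inf_priority G s n \<longleftrightarrow>
     infinite {i. priority G (s i) = n} \<and>
     (\<forall>m. infinite {i. priority G (s i) = m} \<longrightarrow> m \<le> n)"

text \<open>If the priorities along \<open>s\<close> are unbounded there may be no highest priority occurring
  infinitely often; then neither player wins \<open>s\<close>.\<close>

definition game_won_by :: "'v parity_game \<Rightarrow> (nat \<Rightarrow> 'v) \<Rightarrow> player \<Rightarrow> bool" where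
  "game_won_by G s \<alpha> \<longleftrightarrow> (\<exists>n. highest_inf_priority G s n \<and> player_of_priority n = \<alpha>)"

datatype 'v play = Halting "'v list" | Infinite "nat \<Rightarrow> 'v"

fun first :: "'v play \<Rightarrow> 'v" where
  "first (Halting vs) = hd vs"
| "first (Infinite s) = s 0"

fun param_play :: "'v parity_game \<Rightarrow> ('v \<rightharpoonup> player) \<Rightarrow> 'v play \<Rightarrow> bool" where
  "param_play G P (Halting vs) \<longleftrightarrow>
     vs \<noteq> [] \<and> set vs \<subseteq> nodes G \<and> last vs \<in> dom P \<and>
     (\<forall>i. Suc i < length vs \<longrightarrow> vs ! i \<notin> dom P \<and> (vs ! i, vs ! Suc i) \<in> moves G)"
| "param_play G P (Infinite s) \<longleftrightarrow>
     (\<forall>i. s i \<in> nodes G \<and> s i \<notin> dom P \<and> (s i, s (Suc i)) \<in> moves G)"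

fun param_won_by ::
    "'v parity_game \<Rightarrow> ('v \<rightharpoonup> player) \<Rightarrow> 'v play \<Rightarrow> player \<Rightarrow> bool" where
  "param_won_by G P (Halting vs) \<alpha> \<longleftrightarrow> P (last vs) = Some \<alpha>"
| "param_won_by G P (Infinite s) \<alpha> \<longleftrightarrow> game_won_by G s \<alpha>"

text \<open>A strategy is a partial function represented by its graph. It has to choose moves of the
  game: a choice that is not a move would leave no consistent play at all, and would therefore
  be vacuously winning.\<close>

definition strategy :: "'v parity_game \<Rightarrow> player \<Rightarrow> ('v \<times> 'v) set \<Rightarrow> bool" where
  "strategy G \<alpha> \<sigma> \<longleftrightarrow>
     single_valued \<sigma> \<and> \<sigma> \<subseteq> moves G \<and> Domain \<sigma> \<subseteq> {v \<in> nodes G. owner G v = \<alpha>}"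

fun consistent :: "('v \<times> 'v) set \<Rightarrow> 'v play \<Rightarrow> bool" where
  "consistent \<sigma> (Halting vs) \<longleftrightarrow>
     (\<forall>i. Suc i < length vs \<longrightarrow> vs ! i \<in> Domain \<sigma> \<longrightarrow> (vs ! i, vs ! Suc i) \<in> \<sigma>)"
| "consistent \<sigma> (Infinite s) \<longleftrightarrow>
     (\<forall>i. s i \<in> Domain \<sigma> \<longrightarrow> (s i, s (Suc i)) \<in> \<sigma>)"

definition wins_from ::
    "'v parity_game \<Rightarrow> ('v \<rightharpoonup> player) \<Rightarrow> player \<Rightarrow> ('v \<times> 'v) set \<Rightarrow> 'v \<Rightarrow> bool" where
  "wins_from G P \<alpha> \<sigma> v \<longleftrightarrow>
     (\<forall>\<pi>. param_play G P \<pi> \<and> first \<pi> = v \<and> consistent \<sigma> \<pi> \<longrightarrow> param_won_by G P \<pi> \<alpha>)"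

text \<open>The equivalence says that \<open>W v\<close> is the one and only player with a winning strategy from
  \<open>v\<close>; in particular, the existence of a winning function includes determinacy.\<close>

definition is_winning_function ::
    "'v parity_game \<Rightarrow> ('v \<rightharpoonup> player) \<Rightarrow> ('v \<Rightarrow> player) \<Rightarrow> bool" where
  "is_winning_function G P W \<longleftrightarrow>
     (\<forall>v\<in>nodes G. \<forall>\<alpha>. W v = \<alpha> \<longleftrightarrow> (\<exists>\<sigma>. strategy G \<alpha> \<sigma> \<and> wins_from G P \<alpha> \<sigma> v))"

definition direct_justification ::
    "'v parity_game \<Rightarrow> player \<Rightarrow> 'v \<Rightarrow> ('v \<times> 'v) set \<Rightarrow> bool" where
  "direct_justification G \<alpha> v dj \<longleftrightarrow>
     (owner G v = \<alpha> \<longrightarrow> (\<exists>w. (v, w) \<in> moves G \<and> dj = {(v, w)})) \<and>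
     (owner G v = opponent \<alpha> \<longrightarrow> dj = {(v, w) | w. (v, w) \<in> moves G})"

definition wins_under :: "('v \<times> 'v) set \<Rightarrow> 'v \<Rightarrow> player \<Rightarrow> ('v \<Rightarrow> player) \<Rightarrow> bool" where
  "wins_under dj v \<alpha> H \<longleftrightarrow> (\<forall>w. (v, w) \<in> dj \<longrightarrow> H w = \<alpha>)"

text \<open>A justification for \<open>G\<close> has the same nodes as \<open>G\<close>, so only its edges \<open>D\<close> and its
  hypothesis \<open>H\<close> are recorded.\<close>

record 'v justification =
  jedges :: "('v \<times> 'v) set"
  hyp :: "'v \<Rightarrow> player"

definition is_justification :: "'v parity_game \<Rightarrow> 'v justification \<Rightarrow> bool" where
  "is_justification G J \<longleftrightarrow> jedges J \<subseteq> moves G"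

definition out_edges :: "'v justification \<Rightarrow> 'v \<Rightarrow> ('v \<times> 'v) set" where
  "out_edges J v = {(v, w) | w. (v, w) \<in> jedges J}"

definition justified :: "'v justification \<Rightarrow> 'v \<Rightarrow> bool" where
  "justified J v \<longleftrightarrow> out_edges J v \<noteq> {}"

definition weakly_winning :: "'v parity_game \<Rightarrow> 'v justification \<Rightarrow> bool" where
  "weakly_winning G J \<longleftrightarrow>
     (\<forall>v\<in>nodes G. justified J v \<longrightarrow>
        direct_justification G (hyp J v) v (out_edges J v) \<and>
        wins_under (out_edges J v) v (hyp J v) (hyp J))"

definition winning :: "'v parity_game \<Rightarrow> 'v justification \<Rightarrow> bool" where
  "winning G J \<longleftrightarrow>
     weakly_winning G J \<and>
     (\<forall>s. infinite_path (jedges J) s \<longrightarrow> game_play G s \<and> game_won_by G s (hyp J (s 0)))"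

definition param_of :: "'v parity_game \<Rightarrow> 'v justification \<Rightarrow> ('v \<rightharpoonup> player)" where
  "param_of G J = (\<lambda>v. Some (hyp J v)) |` {v \<in> nodes G. \<not> justified J v}"

definition just_strategy ::
    "'v parity_game \<Rightarrow> 'v justification \<Rightarrow> player \<Rightarrow> ('v \<times> 'v) set" where
  "just_strategy G J \<alpha> = {(v, w) \<in> jedges J. owner G v = \<alpha> \<and> hyp J v = \<alpha>}"

end

theory Submission
  imports Defs
begin

text \<open>Along a play from \<open>v\<close> that is consistent with \<open>\<sigma>\<^sub>J\<^sub>,\<^sub>\<alpha>\<close>, where \<open>H v = \<alpha>\<close>, every step is an
  edge of \<open>D\<close> and \<open>H\<close> keeps the value \<open>\<alpha>\<close>: at nodes of \<open>\<alpha>\<close> the strategy enforces it, and at nodes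
  of the opponent the justification contains all moves. Hence a halting play ends in an
  unjustified node with hypothesis \<open>\<alpha>\<close>, and an infinite play is an infinite path of \<open>D\<close>.
  Conversely, the opponent has no winning strategy from \<open>v\<close>, because it would
  have a play in common with \<open>\<sigma>\<^sub>J\<^sub>,\<^sub>\<alpha>\<close>, and no play is won by both players.\<close>

lemma player_cases_opponent: "\<beta> = \<alpha> \<or> \<beta> = opponent \<alpha>"
  by (cases \<alpha>; cases \<beta>) auto

text \<open>On an infinite play, two priorities that are both highest among those occurring
  infinitely often bound each other. So there is at most one winner, even where unbounded priorities
  leave none.\<close>

lemma param_won_by_unique:
  assumes "param_won_by G P \<pi> \<alpha>" and "param_won_by G P \<pi> \<beta>"
  shows "\<alpha> = \<beta>"
proof (cases \<pi>)
  case (Halting vs)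
  with assms show ?thesis by simp
next
  case (Infinite s)
  with assms obtain m n
    where "highest_inf_priority G s m" "player_of_priority m = \<alpha>"
      and "highest_inf_priority G s n" "player_of_priority n = \<beta>"
    by (auto simp: game_won_by_def)
  moreover from this have "m = n"
    unfolding highest_inf_priority_def by (meson antisym)
  ultimately show ?thesis by simp
qed

text \<open>Strategies of different players have disjoint domains, so at every node some move
  respects both. Iterating such moves from \<open>v\<close> and stopping at the first node of
  \<open>dom P\<close>, if there is one, gives the play.\<close>

lemma common_play_exists:
  assumes G: "is_parity_game G" and v: "v \<in> nodes G"
    and \<sigma>: "strategy G \<alpha> \<sigma>" and \<tau>: "strategy G \<beta> \<tau>" and "\<alpha> \<noteq> \<beta>"
  obtains \<pi> where "param_play G P \<pi>" "first \<pi> = v" "consistent \<sigma> \<pi>" "consistent \<tau> \<pi>"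
proof -
  have disj: "x \<notin> Domain \<tau>" if "x \<in> Domain \<sigma>" for x
    using that \<sigma> \<tau> \<open>\<alpha> \<noteq> \<beta>\<close> unfolding strategy_def by blast
  have "\<exists>y. (x, y) \<in> moves G \<and> (x \<in> Domain \<sigma> \<longrightarrow> (x, y) \<in> \<sigma>) \<and>
      (x \<in> Domain \<tau> \<longrightarrow> (x, y) \<in> \<tau>)" if "x \<in> nodes G" for x
  proof -
    consider "x \<in> Domain \<sigma>" | "x \<in> Domain \<tau>" | "x \<notin> Domain \<sigma>" "x \<notin> Domain \<tau>" by blast
    then show ?thesis
    proof cases
      case 1
      with disj \<sigma> show ?thesis unfolding strategy_def by blast
    next
      case 2
      with disj \<tau> show ?thesis unfolding strategy_def by blast
    next
      case 3
      with that G show ?thesis unfolding is_parity_game_def by blast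
    qed
  qed
  then obtain f where f: "\<And>x. x \<in> nodes G \<Longrightarrow> (x, f x) \<in> moves G"
      "\<And>x. x \<in> nodes G \<Longrightarrow> x \<in> Domain \<sigma> \<Longrightarrow> (x, f x) \<in> \<sigma>"
      "\<And>x. x \<in> nodes G \<Longrightarrow> x \<in> Domain \<tau> \<Longrightarrow> (x, f x) \<in> \<tau>"
    by metis
  \<comment> \<open>This walk ignores \<open>P\<close>; it is cut off afterwards if it meets
    \<open>dom P\<close>.\<close>
  define s where "s i = (f ^^ i) v" for i
  have s_0: "s 0 = v" and s_Suc: "s (Suc i) = f (s i)" for i
    by (simp_all add: s_def)
  have s_nodes: "s i \<in> nodes G" for i
  proof (induction i)
    case 0
    show ?case using v by (simp add: s_0)
  next
    case (Suc i)
    then show ?case using f(1) G by (force simp: s_Suc is_parity_game_def)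
  qed
  have s_step: "(s i, s (Suc i)) \<in> moves G" "s i \<in> Domain \<sigma> \<longrightarrow> (s i, s (Suc i)) \<in> \<sigma>"
      "s i \<in> Domain \<tau> \<longrightarrow> (s i, s (Suc i)) \<in> \<tau>" for i
    using f[OF s_nodes] s_Suc by simp_all
  show thesis
  proof (cases "\<exists>i. s i \<in> dom P")
    case False
    show thesis
      by (rule that[of "Infinite s"])
        (use False s_0 s_nodes s_step in \<open>simp_all del: not_None_eq\<close>)
  next
    case True
    define n where "n = (LEAST i. s i \<in> dom P)"
    \<comment> \<open>The node \<open>s n\<close> is included: a halting play ends in
      \<open>dom P\<close>, and minimality of \<open>n\<close> keeps all earlier nodes
      outside.\<close>
    define vs where "vs = map s [0..<Suc n]"
    have nth: "vs ! i = s i" if "i \<le> n" for i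
      using that by (simp add: vs_def del: upt_Suc)
    have len: "length vs = Suc n" and set: "set vs \<subseteq> nodes G"
      using s_nodes by (auto simp: vs_def)
    have ne: "vs \<noteq> []" using len by auto
    have last: "last vs = s n" and hd: "hd vs = v"
      using ne len nth s_0 by (simp_all add: last_conv_nth hd_conv_nth)
    have "s n \<in> dom P"
      unfolding n_def using True by (rule LeastI_ex)
    moreover have "s i \<notin> dom P" if "i < n" for i
      using that not_less_Least unfolding n_def by blast
    ultimately show thesis
      by (intro that[of "Halting vs"])
        (use ne len set last hd s_step in \<open>simp_all add: nth del: not_None_eq\<close>)
  qed
qed

lemma dom_param_of: "dom (param_of G J) = {v \<in> nodes G. \<not> justified J v}"
  by (auto simp: param_of_def restrict_map_def split: if_splits)

text \<open>Where the owner of a node is also its hypothesis, the direct justification is a single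
  edge, which makes the relation single-valued.\<close>

lemma strategy_just_strategy:
  assumes G: "is_parity_game G" and J: "is_justification G J" and W: "weakly_winning G J"
  shows "strategy G \<alpha> (just_strategy G J \<alpha>)"
proof -
  have "y = z"
    if "(x, y) \<in> just_strategy G J \<alpha>" "(x, z) \<in> just_strategy G J \<alpha>" for x y z
  proof -
    have xy: "(x, y) \<in> out_edges J x" and xz: "(x, z) \<in> out_edges J x"
      and own: "owner G x = hyp J x" and "x \<in> nodes G"
      using that G J
      by (auto simp: just_strategy_def out_edges_def is_justification_def is_parity_game_def)
    then have "direct_justification G (hyp J x) x (out_edges J x)"
      using W by (auto simp: weakly_winning_def justified_def)
    with xy xz own show ?thesis by (auto simp: direct_justification_def)
  qed
  then show ?thesis
    using G J unfolding strategy_def single_valued_def is_justification_def is_parity_game_def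
    by (auto simp: just_strategy_def)
qed

text \<open>The invariant for one move, stated without reference to a play so that it serves halting
  and infinite plays alike.\<close>

lemma consistent_step:
  assumes W: "weakly_winning G J" and x: "x \<in> nodes G" "justified J x" "hyp J x = \<alpha>"
    and xy: "(x, y) \<in> moves G"
    and cons: "x \<in> Domain (just_strategy G J \<alpha>) \<Longrightarrow> (x, y) \<in> just_strategy G J \<alpha>"
  shows "(x, y) \<in> jedges J \<and> hyp J y = \<alpha>"
proof -
  have dj: "direct_justification G \<alpha> x (out_edges J x)"
    and under: "wins_under (out_edges J x) x \<alpha> (hyp J)"
    using W x by (auto simp: weakly_winning_def)
  have "(x, y) \<in> jedges J"
  proof (cases "owner G x = \<alpha>")
    case True
    with x have "x \<in> Domain (just_strategy G J \<alpha>)"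
      by (auto simp: justified_def out_edges_def just_strategy_def)
    with cons show ?thesis by (auto simp: just_strategy_def)
  next
    case False
    then have "owner G x = opponent \<alpha>" using player_cases_opponent by blast
    with dj xy have "(x, y) \<in> out_edges J x" by (auto simp: direct_justification_def)
    then show ?thesis by (auto simp: out_edges_def)
  qed
  with under show ?thesis by (auto simp: wins_under_def out_edges_def)
qed

lemma just_strategy_wins_from:
  assumes W: "winning G J" and v: "hyp J v = \<alpha>"
  shows "wins_from G (param_of G J) \<alpha> (just_strategy G J \<alpha>) v"
  unfolding wins_from_def
proof (intro allI impI, elim conjE)
  fix \<pi>
  assume play: "param_play G (param_of G J) \<pi>" and first: "first \<pi> = v"
    and cons: "consistent (just_strategy G J \<alpha>) \<pi>"
  have weak: "weakly_winning G J" using W by (simp add: winning_def)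
  show "param_won_by G (param_of G J) \<pi> \<alpha>"
  proof (cases \<pi>)
    case (Halting vs)
    have ne: "vs \<noteq> []" and nodes: "set vs \<subseteq> nodes G"
      and last: "last vs \<in> dom (param_of G J)"
      and step: "\<And>i. Suc i < length vs \<Longrightarrow>
        vs ! i \<notin> dom (param_of G J) \<and> (vs ! i, vs ! Suc i) \<in> moves G"
      using play unfolding Halting by simp_all
    have "hyp J (vs ! i) = \<alpha>" if "i < length vs" for i
      using that
    proof (induction i)
      case 0
      then show ?case using first v Halting ne by (simp add: hd_conv_nth)
    next
      case (Suc i)
      have x: "vs ! i \<in> nodes G" using Suc.prems nodes nth_mem[of i vs] by auto
      \<comment> \<open>A node with a successor in the play lies outside the domain of
        \<open>param_of G J\<close>, and is therefore justified.\<close>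
      have just: "justified J (vs ! i)" and move: "(vs ! i, vs ! Suc i) \<in> moves G"
        using step[OF Suc.prems] x unfolding dom_param_of by auto
      have hyp: "hyp J (vs ! i) = \<alpha>" using Suc by simp
      show ?case
        using consistent_step[OF weak x just hyp move] cons Suc.prems Halting by simp
    qed
    then have "hyp J (last vs) = \<alpha>" using ne by (simp add: last_conv_nth)
    then show ?thesis using last unfolding Halting
      by (auto simp: param_of_def restrict_map_def split: if_splits)
  next
    case (Infinite s)
    have nodes: "s i \<in> nodes G" and just: "justified J (s i)"
      and move: "(s i, s (Suc i)) \<in> moves G" for i
      using play unfolding Infinite param_play.simps dom_param_of by auto
    have step: "(s i, s (Suc i)) \<in> jedges J \<and> hyp J (s (Suc i)) = \<alpha>"
      if "hyp J (s i) = \<alpha>" for i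
      using consistent_step[OF weak nodes just that move] cons Infinite by simp
    \<comment> \<open>\<open>step\<close> presupposes the hypothesis value at \<open>s i\<close>, so
      that value is propagated first; only then is every move known to be an edge of
      \<open>J\<close>.\<close>
    have hyp: "hyp J (s i) = \<alpha>" for i
      by (induction i) (use first v Infinite step in auto)
    have "infinite_path (jedges J) s" using step hyp by (simp add: infinite_path_def)
    then show ?thesis using W hyp Infinite by (auto simp: winning_def)
  qed
qed

theorem theorem1:
  fixes G :: "'v parity_game" and J :: "'v justification"
  assumes "is_parity_game G"
    and "is_justification G J"
    and "winning G J"
  shows "is_winning_function G (param_of G J) (hyp J) \<and>
    (\<forall>\<alpha>. strategy G \<alpha> (just_strategy G J \<alpha>) \<and>
      (\<forall>v\<in>nodes G. hyp J v = \<alpha> \<longrightarrow>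
        wins_from G (param_of G J) \<alpha> (just_strategy G J \<alpha>) v))"
proof -
  have strat: "strategy G \<alpha> (just_strategy G J \<alpha>)" for \<alpha>
    using assms strategy_just_strategy by (auto simp: winning_def)
  note wins = just_strategy_wins_from[OF assms(3)]
  \<comment> \<open>The direction of the equivalence in \<open>is_winning_function\<close> that
    excludes a winning strategy for the other player: such a \<open>\<sigma>\<close> is played
    against the strategy of \<open>J\<close> for \<open>hyp J v\<close>.\<close>
  have "hyp J v = \<alpha>"
    if v: "v \<in> nodes G" and \<sigma>: "strategy G \<alpha> \<sigma>" "wins_from G (param_of G J) \<alpha> \<sigma> v" for v \<alpha> \<sigma>
  proof (rule ccontr)
    assume "hyp J v \<noteq> \<alpha>"
    with common_play_exists[OF assms(1) v strat \<sigma>(1)]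
    obtain \<pi> where "param_play G (param_of G J) \<pi>" "first \<pi> = v"
      "consistent (just_strategy G J (hyp J v)) \<pi>" "consistent \<sigma> \<pi>"
      by metis
    then have "param_won_by G (param_of G J) \<pi> (hyp J v)" "param_won_by G (param_of G J) \<pi> \<alpha>"
      using wins[OF refl] \<sigma>(2) unfolding wins_from_def by blast+
    with \<open>hyp J v \<noteq> \<alpha>\<close> show False using param_won_by_unique by blast
  qed
  then have "is_winning_function G (param_of G J) (hyp J)"
    unfolding is_winning_function_def using strat wins by blast
  with strat wins show ?thesis by blast
qed

end
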